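(* Let $(X,d)$ be a compact quasihypermetric space with $M(X)<\infty$. Then the semi-inner product space $E_0(X)$ is complete if and only if $X$ is finite.
   Context: A metric space $(X,d)$ is called quasihypermetric if for all $n\in\mathbb{N}$, all $\alpha_1,\dots,\alpha_n\in\mathbb{R}$ with $\sum_{i=1}^n\alpha_i=0$ and all $x_1,\dots,x_n\in X$ one has $\sum_{i,j=1}^n\alpha_i\alpha_j d(x_i,x_j)\le 0$. For a compact metric space $(X,d)$, $\mathcal{M}(X)$ is the space of all finite signed Borel measures on $X$; $\mathcal{M}_0(X)$ and $\mathcal{M}_1(X)$ are the sets of those of total mass $0$ and $1$ respectively. For $\mu,\nu\in\mathcal{M}(X)$, $I(\mu,\nu)=\int_X\int_X d(x,y)\,d\mu(x)\,d\nu(y)$ and $I(\mu)=I(\mu,\mu)$. $M(X)=\sup\{I(\mu):\mu\in\mathcal{M}_1(X)\}$. When $(X,d)$ is compact quasihypermetric, $(\mu\mid\nu)=-I(\mu,\nu)$ is a semi-inner product (symmetric, positive semidefinite bilinear form) on $\mathcal{M}_0(X)$, with seminorm $\|\mu\|=[-I(\mu)]^{1/2}$; $E_0(X)$ denotes $\mathcal{M}_0(X)$ with this semi-inner product. Completeness means that every sequence that is Cauchy for the seminorm converges in the seminorm to some (not necessarily unique) element of the space. *)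

theory Defs
  imports "HOL-Analysis.Analysis"
begin

text \<open>A finite signed measure on the measurable space \<open>M\<close> is a real-valued, countably additive
  function on \<open>sets M\<close>.  It is normalised to \<open>0\<close> outside \<open>sets M\<close>, so that equality of functions is
  equality of signed measures.\<close>

definition finite_signed_measures :: "'a measure \<Rightarrow> ('a set \<Rightarrow> real) set" where
  "finite_signed_measures M =
     {\<mu>. (\<forall>A. A \<notin> sets M \<longrightarrow> \<mu> A = 0) \<and>
         (\<forall>A :: nat \<Rightarrow> 'a set. range A \<subseteq> sets M \<longrightarrow> disjoint_family A \<longrightarrow>
            (\<lambda>i. \<mu> (A i)) sums \<mu> (\<Union>i. A i))}"

text \<open>The positive part \<open>\<mu>\<^sup>+\<close> of the Jordan decomposition, \<open>\<mu>\<^sup>+(A) = sup {\<mu>(B) | B \<subseteq> A}\<close>;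
  the negative part is the positive part of \<open>- \<mu>\<close>.  (\<open>ennreal\<close> sends negative reals
  to \<open>0\<close>, which is harmless as \<open>B = {}\<close> is admitted.)\<close>

definition pos_part :: "'a measure \<Rightarrow> ('a set \<Rightarrow> real) \<Rightarrow> 'a measure" where
  "pos_part M \<mu> =
     measure_of (space M) (sets M) (\<lambda>A. SUP B\<in>{B \<in> sets M. B \<subseteq> A}. ennreal (\<mu> B))"

definition signed_integral :: "'a measure \<Rightarrow> ('a set \<Rightarrow> real) \<Rightarrow> ('a \<Rightarrow> real) \<Rightarrow> real" where
  "signed_integral M \<mu> f =
     integral\<^sup>L (pos_part M \<mu>) f - integral\<^sup>L (pos_part M (- \<mu>)) f"

text \<open>A compact metric space is a compact subset \<open>X\<close> of a type of class \<open>metric_space\<close>, with the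
  induced metric; its Borel sets are those of \<open>restrict_space borel X\<close>.\<close>

definition quasihypermetric :: "'a::metric_space set \<Rightarrow> bool" where
  "quasihypermetric X \<longleftrightarrow>
     (\<forall>(n::nat) (\<alpha> :: nat \<Rightarrow> real) (x :: nat \<Rightarrow> 'a).
        (\<Sum>i<n. \<alpha> i) = 0 \<longrightarrow> (\<forall>i<n. x i \<in> X) \<longrightarrow>
        (\<Sum>i<n. \<Sum>j<n. \<alpha> i * \<alpha> j * dist (x i) (x j)) \<le> 0)"

definition signed_borel_measures :: "'a::metric_space set \<Rightarrow> ('a set \<Rightarrow> real) set" where
  "signed_borel_measures X = finite_signed_measures (restrict_space borel X)"

definition signed_borel_measures_of_mass :: "real \<Rightarrow> 'a::metric_space set \<Rightarrow> ('a set \<Rightarrow> real) set" where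
  "signed_borel_measures_of_mass c X = {\<mu> \<in> signed_borel_measures X. \<mu> X = c}"

definition energy :: "'a::metric_space set \<Rightarrow> ('a set \<Rightarrow> real) \<Rightarrow> ('a set \<Rightarrow> real) \<Rightarrow> real" where
  "energy X \<mu> \<nu> =
     signed_integral (restrict_space borel X) \<nu>
       (\<lambda>y. signed_integral (restrict_space borel X) \<mu> (\<lambda>x. dist x y))"

definition max_energy :: "'a::metric_space set \<Rightarrow> ereal" where
  "max_energy X = (SUP \<mu>\<in>signed_borel_measures_of_mass 1 X. ereal (energy X \<mu> \<mu>))"

definition E0_inner :: "'a::metric_space set \<Rightarrow> ('a set \<Rightarrow> real) \<Rightarrow> ('a set \<Rightarrow> real) \<Rightarrow> real" where
  "E0_inner X \<mu> \<nu> = - energy X \<mu> \<nu>"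

definition E0_seminorm :: "'a::metric_space set \<Rightarrow> ('a set \<Rightarrow> real) \<Rightarrow> real" where
  "E0_seminorm X \<mu> = sqrt (E0_inner X \<mu> \<mu>)"

definition seminorm_complete :: "('v::minus) set \<Rightarrow> ('v \<Rightarrow> real) \<Rightarrow> bool" where
  "seminorm_complete V p \<longleftrightarrow>
     (\<forall>\<sigma> :: nat \<Rightarrow> 'v. range \<sigma> \<subseteq> V \<longrightarrow>
        (\<forall>\<epsilon>>0. \<exists>N. \<forall>m\<ge>N. \<forall>n\<ge>N. p (\<sigma> m - \<sigma> n) < \<epsilon>) \<longrightarrow>
        (\<exists>v\<in>V. (\<lambda>n. p (\<sigma> n - v)) \<longlonglongrightarrow> 0))"

definition E0_complete :: "'a::metric_space set \<Rightarrow> bool" where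
  "E0_complete X \<longleftrightarrow> seminorm_complete (signed_borel_measures_of_mass 0 X) (E0_seminorm X)"

end

theory Submission
  imports Defs
begin

text \<open>Integrals of continuous functions against signed measures are limits of Riemann sums over
  partitions of \<open>X\<close> into small Borel sets; hence \<open>I\<close> is bilinear and symmetric, and
  quasihypermetricity makes \<open>(\<mu> | \<nu>) = - I(\<mu>, \<nu>)\<close> positive semidefinite on all of \<open>\<M>\<^sub>0(X)\<close>.

  If \<open>X\<close> is infinite, choose points \<open>x\<^sub>k \<noteq> y\<close> of \<open>X\<close> with \<open>d\<^sub>k = d(x\<^sub>k, y) < 16\<^sup>-\<^sup>k / 2\<close>, and let
  \<open>u\<^sub>k = \<delta>(x\<^sub>k) - \<delta>(y)\<close>. Then \<open>(u\<^sub>k | u\<^sub>k) = 2 d\<^sub>k\<close>, all \<open>(u\<^sub>k | u\<^sub>j)\<close> are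
  nonnegative by the triangle inequality, and \<open>\<bar>(v | u\<^sub>k)\<bar> \<le> d\<^sub>k \<parallel>v\<parallel>\<^sub>T\<^sub>V\<close> because the potential of
  \<open>v\<close> is Lipschitz. The partial sums of \<open>\<Sum>\<^sub>k 2\<^sup>k u\<^sub>k\<close> are Cauchy, but a limit \<open>v\<close> would satisfy
  \<open>2\<^sup>k \<cdot> 2 d\<^sub>k \<le> (v | u\<^sub>k) \<le> d\<^sub>k \<parallel>v\<parallel>\<^sub>T\<^sub>V\<close> for every \<open>k\<close>, so its total variation would be infinite.
  If \<open>X\<close> is finite, the space is finite-dimensional and therefore complete.\<close>

section \<open>Finite signed measures\<close>

lemma fsm_notin: "\<mu> \<in> finite_signed_measures M \<Longrightarrow> A \<notin> sets M \<Longrightarrow> \<mu> A = 0"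
  by (simp add: finite_signed_measures_def)

lemma fsm_sums:
  "\<mu> \<in> finite_signed_measures M \<Longrightarrow> range A \<subseteq> sets M \<Longrightarrow> disjoint_family A \<Longrightarrow>
    (\<lambda>i::nat. \<mu> (A i)) sums \<mu> (\<Union>i. A i)"
  by (simp add: finite_signed_measures_def)

lemma fsm_empty: assumes "\<mu> \<in> finite_signed_measures M" shows "\<mu> {} = 0"
proof -
  have "(\<lambda>i::nat. \<mu> {}) sums \<mu> {}"
    using fsm_sums[OF assms, of "\<lambda>_. {}"] by (simp add: disjoint_family_on_def)
  then show ?thesis
    by (simp add: sums_iff summable_const_iff)
qed

lemma fsm_Un:
  assumes \<mu>: "\<mu> \<in> finite_signed_measures M" and "A \<in> sets M" "B \<in> sets M" "A \<inter> B = {}"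
  shows "\<mu> (A \<union> B) = \<mu> A + \<mu> B"
proof -
  have "(\<lambda>i. \<mu> (binaryset A B i)) sums \<mu> (\<Union>i. binaryset A B i)"
    using assms
    by (intro fsm_sums) (auto simp: range_binaryset_eq disjoint_family_on_def binaryset_def)
  moreover have "(\<lambda>i. \<mu> (binaryset A B i)) sums (\<mu> A + \<mu> B)"
    by (rule binaryset_sums) (rule fsm_empty[OF \<mu>])
  ultimately show ?thesis
    by (metis UN_binaryset_eq sums_unique2)
qed

lemma fsm_Diff:
  assumes \<mu>: "\<mu> \<in> finite_signed_measures M" and "A \<in> sets M" "B \<in> sets M" "B \<subseteq> A"
  shows "\<mu> (A - B) = \<mu> A - \<mu> B"
  using fsm_Un[of \<mu> M B "A - B"] assms by (simp add: Un_absorb1)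

lemma fsm_UN:
  assumes \<mu>: "\<mu> \<in> finite_signed_measures M"
    and "finite I" "\<And>i. i \<in> I \<Longrightarrow> A i \<in> sets M" "disjoint_family_on A I"
  shows "\<mu> (\<Union>i\<in>I. A i) = (\<Sum>i\<in>I. \<mu> (A i))"
  using assms(2-)
proof (induction I)
  case empty
  then show ?case by (simp add: fsm_empty[OF \<mu>])
next
  case (insert i I)
  have "A i \<inter> (\<Union>j\<in>I. A j) = {}"
    using insert.prems(2) insert.hyps(2) by (auto simp: disjoint_family_on_def)
  then have "\<mu> (A i \<union> (\<Union>j\<in>I. A j)) = \<mu> (A i) + \<mu> (\<Union>j\<in>I. A j)"
    using insert by (intro fsm_Un[OF \<mu>]) auto
  moreover have "disjoint_family_on A I"
    using insert.prems(2) by (auto simp: disjoint_family_on_def)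
  ultimately show ?case
    using insert by simp
qed

lemma fsm_lincomb:
  assumes "\<mu> \<in> finite_signed_measures M" "\<nu> \<in> finite_signed_measures M"
  shows "(\<lambda>A. a * \<mu> A + b * \<nu> A) \<in> finite_signed_measures M"
  using assms by (auto simp: finite_signed_measures_def intro!: sums_add sums_mult)

lemma fsm_uminus:
  assumes "\<mu> \<in> finite_signed_measures M" shows "- \<mu> \<in> finite_signed_measures M"
  using fsm_lincomb[OF assms assms, of "-1" 0] by (simp add: fun_Compl_def)

text \<open>Otherwise one keeps halving: of two pieces of a set on whose subsets
  \<open>\<mu>\<close> is unbounded, one inherits the unboundedness, and the other, of measure
  exceeding 1 in absolute value, is discarded. The discarded pieces are disjoint, so their measures
  should form a convergent series, yet they do not tend to 0.\<close>

lemma fsm_bounded: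
  assumes \<mu>: "\<mu> \<in> finite_signed_measures M"
  shows "\<exists>C. \<forall>A\<in>sets M. \<bar>\<mu> A\<bar> \<le> C"
proof (rule ccontr)
  define U where "U S \<longleftrightarrow> S \<in> sets M \<and> (\<forall>C. \<exists>B\<in>sets M. B \<subseteq> S \<and> \<bar>\<mu> B\<bar> > C)" for S
  assume "\<not> ?thesis"
  then have U0: "U (space M)"
    unfolding U_def by (meson not_le sets.sets_into_space sets.top)
  have step: "\<exists>T. U T \<and> T \<subseteq> S \<and> \<bar>\<mu> (S - T)\<bar> > 1" if "U S" for S
  proof -
    have S: "S \<in> sets M" using that by (simp add: U_def)
    \<comment> \<open>The margin \<open>\<bar>\<mu> S\<bar> + 1\<close> forces both
      \<open>\<bar>\<mu> B\<bar> > 1\<close> and \<open>\<bar>\<mu> (S - B)\<bar> > 1\<close>, so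
      either half may be the one discarded.\<close>
    obtain B where B: "B \<in> sets M" "B \<subseteq> S" "\<bar>\<mu> B\<bar> > \<bar>\<mu> S\<bar> + 1"
      using \<open>U S\<close> unfolding U_def by blast
    have D: "\<mu> (S - B) = \<mu> S - \<mu> B" by (rule fsm_Diff) fact+
    have "U B \<or> U (S - B)"
    proof (rule ccontr)
      assume "\<not> ?thesis"
      then obtain C1 C2 where C: "\<And>T. T \<in> sets M \<Longrightarrow> T \<subseteq> B \<Longrightarrow> \<bar>\<mu> T\<bar> \<le> C1"
          "\<And>T. T \<in> sets M \<Longrightarrow> T \<subseteq> S - B \<Longrightarrow> \<bar>\<mu> T\<bar> \<le> C2"
        using B(1) S unfolding U_def by (meson not_le sets.Diff)
      obtain T where T: "T \<in> sets M" "T \<subseteq> S" "\<bar>\<mu> T\<bar> > C1 + C2"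
        using \<open>U S\<close> unfolding U_def by blast
      have "\<mu> ((T \<inter> B) \<union> (T - B)) = \<mu> (T \<inter> B) + \<mu> (T - B)"
        using T B by (intro fsm_Un[OF \<mu>]) auto
      moreover have "(T \<inter> B) \<union> (T - B) = T" by auto
      ultimately have "\<bar>\<mu> T\<bar> \<le> \<bar>\<mu> (T \<inter> B)\<bar> + \<bar>\<mu> (T - B)\<bar>" by simp
      also have "\<dots> \<le> C1 + C2"
        using T B by (intro add_mono C) auto
      finally show False using T by simp
    qed
    then show ?thesis
    proof
      assume "U B"
      then show ?thesis using B D by (intro exI[of _ B]) auto
    next
      assume "U (S - B)"
      moreover have "S - (S - B) = B" using B by auto
      ultimately show ?thesis using B by (intro exI[of _ "S - B"]) auto
    qed
  qed
  obtain T where T: "\<And>n::nat. U (T n)"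
    "\<And>n. T (Suc n) \<subseteq> T n \<and> \<bar>\<mu> (T n - T (Suc n))\<bar> > 1"
    using dependent_nat_choice[of "\<lambda>_. U" "\<lambda>_ S T. T \<subseteq> S \<and> \<bar>\<mu> (S - T)\<bar> > 1"] U0 step
    by metis
  have dec: "T n \<subseteq> T m" if "m \<le> n" for m n
    using that T(2) by (simp add: lift_Suc_antimono_le)
  have "disjoint_family (\<lambda>n. T n - T (Suc n))"
    unfolding disjoint_family_on_def
  proof (intro ballI impI)
    fix m n :: nat assume "m \<noteq> n"
    then have "Suc m \<le> n \<or> Suc n \<le> m" by auto
    then show "(T m - T (Suc m)) \<inter> (T n - T (Suc n)) = {}"
      using dec by blast
  qed
  then have "(\<lambda>n. \<mu> (T n - T (Suc n))) sums \<mu> (\<Union>n. T n - T (Suc n))"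
    using T(1) by (intro fsm_sums[OF \<mu>]) (auto simp: U_def)
  then have "(\<lambda>n. \<mu> (T n - T (Suc n))) \<longlonglongrightarrow> 0"
    by (simp add: sums_iff summable_LIMSEQ_zero)
  from LIMSEQ_D[OF this, of 1] obtain n where "\<bar>\<mu> (T n - T (Suc n))\<bar> < 1"
    by auto
  with T(2)[of n] show False by simp
qed

section \<open>Positive parts and the Jordan decomposition\<close>

lemma sets_pos_part [simp, measurable_cong]: "sets (pos_part M \<mu>) = sets M"
  and space_pos_part [simp]: "space (pos_part M \<mu>) = space M"
  by (simp_all add: pos_part_def space_measure_of_conv sets.sets_measure_of_eq sets.space_closed)

text \<open>The point is that the supremum is countably additive. Uniting subsets of disjoint sets
  gives superadditivity; cutting a subset \<open>B\<close> of the union into the pieces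
  \<open>B \<inter> A i\<close> gives the converse inequality.\<close>

lemma emeasure_pos_part:
  assumes \<mu>: "\<mu> \<in> finite_signed_measures M" and A: "A \<in> sets M"
  shows "emeasure (pos_part M \<mu>) A = (SUP B\<in>{B \<in> sets M. B \<subseteq> A}. ennreal (\<mu> B))"
proof -
  define F where "F A = (SUP B\<in>{B \<in> sets M. B \<subseteq> A}. ennreal (\<mu> B))" for A
  have F_upper: "ennreal (\<mu> B) \<le> F A" if "B \<in> sets M" "B \<subseteq> A" for A B
    unfolding F_def using that by (intro SUP_upper) auto
  have F_empty: "F {} = 0"
  proof -
    have "{B \<in> sets M. B \<subseteq> {}} = {{}}" by auto
    then show ?thesis by (simp add: F_def fsm_empty[OF \<mu>])
  qed
  have F_add: "F A + F B \<le> F (A \<union> B)" if "A \<in> sets M" "B \<in> sets M" "A \<inter> B = {}" for A B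
  proof -
    have 1: "ennreal (\<mu> C) + ennreal (\<mu> D) \<le> F (A \<union> B)"
      if "C \<in> sets M" "C \<subseteq> A" "D \<in> sets M" "D \<subseteq> B" for C D
    proof -
      \<comment> \<open>\<open>ennreal\<close> is additive only on nonnegative reals. A set of
        negative measure contributes 0 and is simply left out of the union.\<close>
      consider "\<mu> C < 0" | "\<mu> D < 0" | "\<mu> C \<ge> 0" "\<mu> D \<ge> 0" by linarith
      then show ?thesis
      proof cases
        case 1
        then show ?thesis using F_upper[of D "A \<union> B"] that by (auto simp: ennreal_neg)
      next
        case 2
        then show ?thesis using F_upper[of C "A \<union> B"] that by (auto simp: ennreal_neg)
      next
        case 3
        have "\<mu> (C \<union> D) = \<mu> C + \<mu> D"
          using that \<open>A \<inter> B = {}\<close> by (intro fsm_Un[OF \<mu>]) auto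
        then show ?thesis using 3 F_upper[of "C \<union> D" "A \<union> B"] that
          by (auto simp flip: ennreal_plus)
      qed
    qed
    have 2: "F A + ennreal (\<mu> D) \<le> F (A \<union> B)" if "D \<in> sets M" "D \<subseteq> B" for D
    proof -
      have "F A + ennreal (\<mu> D) = (SUP C\<in>{C \<in> sets M. C \<subseteq> A}. ennreal (\<mu> C) + ennreal (\<mu> D))"
        unfolding F_def by (rule ennreal_SUP_add_left[symmetric]) auto
      also have "\<dots> \<le> F (A \<union> B)" using 1 that by (intro SUP_least) auto
      finally show ?thesis .
    qed
    have "F A + F B = (SUP D\<in>{D \<in> sets M. D \<subseteq> B}. F A + ennreal (\<mu> D))"
      unfolding F_def[of B] by (rule ennreal_SUP_add_right) auto
    also have "\<dots> \<le> F (A \<union> B)" using 2 by (intro SUP_least) auto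
    finally show ?thesis .
  qed
  have mono: "F A \<le> F B" if "A \<subseteq> B" for A B
    unfolding F_def using that by (intro SUP_subset_mono) auto
  have "countably_additive (sets M) F"
  proof (rule countably_additiveI)
    fix A :: "nat \<Rightarrow> 'a set"
    assume A: "range A \<subseteq> sets M" "disjoint_family A"
    show "(\<Sum>i. F (A i)) = F (\<Union>i. A i)"
    proof (rule antisym)
      have fin: "(\<Sum>i<n. F (A i)) \<le> F (\<Union>i<n. A i)" for n
      proof (induction n)
        case 0
        then show ?case by simp
      next
        case (Suc n)
        have "(\<Union>i<n. A i) \<inter> A n = {}"
          using A(2) by (auto simp: disjoint_family_on_def) (metis IntI empty_iff nat_neq_iff)
        then have "F (\<Union>i<n. A i) + F (A n) \<le> F ((\<Union>i<n. A i) \<union> A n)"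
          using A(1) by (intro F_add) auto
        moreover have "(\<Union>i<n. A i) \<union> A n = (\<Union>i<Suc n. A i)"
          by (auto simp: lessThan_Suc)
        ultimately show ?case using Suc
          by (metis (mono_tags, lifting) add_right_mono order_trans sum.lessThan_Suc)
      qed
      show "(\<Sum>i. F (A i)) \<le> F (\<Union>i. A i)"
      proof (rule suminf_le_const)
        show "(\<Sum>i<n. F (A i)) \<le> F (\<Union>i. A i)" for n
          by (rule order_trans[OF fin mono]) auto
      qed simp
    next
      show "F (\<Union>i. A i) \<le> (\<Sum>i. F (A i))"
        unfolding F_def[of "\<Union>i. A i"]
      proof (rule SUP_least)
        fix B assume "B \<in> {B \<in> sets M. B \<subseteq> (\<Union>i. A i)}"
        then have B: "B \<in> sets M" "B = (\<Union>i. B \<inter> A i)" by auto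
        have "(\<lambda>i. \<mu> (B \<inter> A i)) sums \<mu> (\<Union>i. B \<inter> A i)"
          using A B(1) by (intro fsm_sums[OF \<mu>]) (auto simp: disjoint_family_on_def)
        then have "(\<lambda>n. ennreal (\<Sum>i<n. \<mu> (B \<inter> A i))) \<longlonglongrightarrow> ennreal (\<mu> B)"
          using B(2) by (intro tendsto_ennrealI) (simp add: sums_def)
        moreover have "ennreal (\<Sum>i<n. \<mu> (B \<inter> A i)) \<le> (\<Sum>i. F (A i))" for n
        proof -
          \<comment> \<open>Negative terms are raised to 0 so that \<open>ennreal\<close> commutes
            with the sum.\<close>
          have "ennreal (\<Sum>i<n. \<mu> (B \<inter> A i)) \<le> ennreal (\<Sum>i<n. max 0 (\<mu> (B \<inter> A i)))"
            by (intro ennreal_leI sum_mono) auto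
          also have "\<dots> = (\<Sum>i<n. ennreal (max 0 (\<mu> (B \<inter> A i))))"
            by (intro sum_ennreal[symmetric]) auto
          also have "\<dots> \<le> (\<Sum>i<n. F (A i))"
            using A(1) B(1) by (intro sum_mono) (auto simp: max_def intro!: F_upper)
          also have "\<dots> \<le> (\<Sum>i. F (A i))" by (rule sum_le_suminf) auto
          finally show ?thesis .
        qed
        ultimately show "ennreal (\<mu> B) \<le> (\<Sum>i. F (A i))"
          by (intro LIMSEQ_le_const2) auto
      qed
    qed
  qed
  then have "emeasure (pos_part M \<mu>) A = F A"
    unfolding pos_part_def F_def[symmetric] using A
    by (subst emeasure_measure_of_sigma)
      (auto simp: positive_def F_empty sets.sigma_algebra_axioms)
  then show ?thesis by (simp add: F_def)
qed

lemma finite_measure_pos_part: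
  assumes \<mu>: "\<mu> \<in> finite_signed_measures M"
  shows "finite_measure (pos_part M \<mu>)"
proof
  obtain C where "\<And>A. A \<in> sets M \<Longrightarrow> \<bar>\<mu> A\<bar> \<le> C" using fsm_bounded[OF \<mu>] by blast
  then have "emeasure (pos_part M \<mu>) (space M) \<le> ennreal C"
    unfolding emeasure_pos_part[OF \<mu> sets.top]
    by (intro SUP_least ennreal_leI) (auto intro: abs_le_D1)
  then show "emeasure (pos_part M \<mu>) (space (pos_part M \<mu>)) \<noteq> \<infinity>"
    by (auto simp: top_unique)
qed

lemma le_measure_pos_part:
  assumes \<mu>: "\<mu> \<in> finite_signed_measures M" and "A \<in> sets M" "B \<in> sets M" "B \<subseteq> A"
  shows "\<mu> B \<le> measure (pos_part M \<mu>) A"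
proof -
  interpret finite_measure "pos_part M \<mu>" by (rule finite_measure_pos_part[OF \<mu>])
  have "ennreal (\<mu> B) \<le> emeasure (pos_part M \<mu>) A"
    unfolding emeasure_pos_part[OF assms(1,2)] using assms by (intro SUP_upper) auto
  then show ?thesis
    by (simp add: emeasure_eq_measure)
qed

lemma measure_pos_part_le:
  assumes \<mu>: "\<mu> \<in> finite_signed_measures M" and A: "A \<in> sets M"
    and le: "\<And>B. B \<in> sets M \<Longrightarrow> B \<subseteq> A \<Longrightarrow> \<mu> B \<le> c"
  shows "measure (pos_part M \<mu>) A \<le> c"
proof -
  have "emeasure (pos_part M \<mu>) A \<le> ennreal c"
    unfolding emeasure_pos_part[OF \<mu> A]
    by (intro SUP_least ennreal_leI) (auto intro: le)
  moreover have "0 \<le> c" using le[of "{}"] by (simp add: fsm_empty[OF \<mu>])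
  ultimately show ?thesis
    by (simp add: measure_def enn2real_leI)
qed

text \<open>For \<open>B \<subseteq> A\<close>, \<mu>(B) = \<mu>(A) - \<mu>(A - B) is at most
  \<mu>(A) plus the negative part of \<open>A\<close>. The supremum over \<open>B\<close> gives one
  inequality, and the same argument for \<open>- \<mu>\<close> gives the other.\<close>

lemma Jordan_decomposition:
  assumes \<mu>: "\<mu> \<in> finite_signed_measures M" and A: "A \<in> sets M"
  shows "\<mu> A = measure (pos_part M \<mu>) A - measure (pos_part M (- \<mu>)) A"
proof -
  have le: "measure (pos_part M \<nu>) A \<le> \<nu> A + measure (pos_part M (- \<nu>)) A"
    if \<nu>: "\<nu> \<in> finite_signed_measures M" for \<nu>
  proof (rule measure_pos_part_le[OF \<nu> A])
    fix B assume B: "B \<in> sets M" "B \<subseteq> A"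
    have "(- \<nu>) (A - B) \<le> measure (pos_part M (- \<nu>)) A"
      using A B by (intro le_measure_pos_part fsm_uminus[OF \<nu>]) auto
    then show "\<nu> B \<le> \<nu> A + measure (pos_part M (- \<nu>)) A"
      using fsm_Diff[OF \<nu> A B] by (simp add: fun_Compl_def)
  qed
  have "- (- \<mu>) = \<mu>" by (simp add: fun_Compl_def)
  then show ?thesis
    using le[OF \<mu>] le[OF fsm_uminus[OF \<mu>]] by (simp add: fun_Compl_def)
qed

section \<open>Total variation and approximation of integrals over partitions\<close>

definition total_variation :: "'a measure \<Rightarrow> ('a set \<Rightarrow> real) \<Rightarrow> real" where
  "total_variation M \<mu> =
     measure (pos_part M \<mu>) (space M) + measure (pos_part M (- \<mu>)) (space M)"

lemma total_variation_nonneg: "0 \<le> total_variation M \<mu>"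
  by (simp add: total_variation_def)

lemma sum_abs_le_total_variation:
  assumes \<mu>: "\<mu> \<in> finite_signed_measures M"
    and I: "finite I" "\<And>i. i \<in> I \<Longrightarrow> A i \<in> sets M" "disjoint_family_on A I"
  shows "(\<Sum>i\<in>I. \<bar>\<mu> (A i)\<bar>) \<le> total_variation M \<mu>"
proof -
  have le: "(\<Sum>i\<in>I. measure (pos_part M \<nu>) (A i)) \<le> measure (pos_part M \<nu>) (space M)"
    if \<nu>: "\<nu> \<in> finite_signed_measures M" for \<nu>
  proof -
    interpret finite_measure "pos_part M \<nu>" by (rule finite_measure_pos_part[OF \<nu>])
    have "(\<Sum>i\<in>I. measure (pos_part M \<nu>) (A i)) = measure (pos_part M \<nu>) (\<Union>i\<in>I. A i)"
      using I by (intro finite_measure_finite_Union[symmetric]) auto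
    also have "\<dots> \<le> measure (pos_part M \<nu>) (space M)"
      using bounded_measure[of "\<Union>i\<in>I. A i"] by simp
    finally show ?thesis .
  qed
  have "(\<Sum>i\<in>I. \<bar>\<mu> (A i)\<bar>) \<le>
      (\<Sum>i\<in>I. measure (pos_part M \<mu>) (A i) + measure (pos_part M (- \<mu>)) (A i))"
    using I by (intro sum_mono) (auto simp: Jordan_decomposition[OF \<mu>] abs_le_iff add_increasing
        add_increasing2 intro: order_trans[of _ 0])
  also have "\<dots> \<le> total_variation M \<mu>"
    using le[OF \<mu>] le[OF fsm_uminus[OF \<mu>]] by (simp add: total_variation_def sum.distrib)
  finally show ?thesis .
qed

text \<open>The step function with value \<open>c i\<close> on \<open>A i\<close> is uniformly
  within \<open>e\<close> of \<open>f\<close>. The \<open>c i\<close> need not be values of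
  \<open>f\<close> on the cells: they will be values at tags that may lie outside them, or
  0.\<close>

lemma (in finite_measure) integral_approx_by_partition:
  fixes f :: "'a \<Rightarrow> real"
  assumes f: "f \<in> borel_measurable M" and bdd: "\<And>x. x \<in> space M \<Longrightarrow> \<bar>f x\<bar> \<le> B"
    and I: "finite I" "\<And>i. i \<in> I \<Longrightarrow> A i \<in> sets M" "disjoint_family_on A I"
      "(\<Union>i\<in>I. A i) = space M"
    and e: "\<And>i x. i \<in> I \<Longrightarrow> x \<in> A i \<Longrightarrow> \<bar>f x - c i\<bar> \<le> e"
  shows "\<bar>integral\<^sup>L M f - (\<Sum>i\<in>I. measure M (A i) * c i)\<bar> \<le> e * measure M (space M)"
proof -
  have int: "integrable M f"
    using f bdd by (intro integrable_const_bound[of _ B]) auto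
  have int2: "integrable M (\<lambda>x. \<Sum>i\<in>I. c i * indicator (A i) x)"
    using I by (intro Bochner_Integration.integrable_sum integrable_mult_right integrable_real_indicator)
      (auto simp: emeasure_eq_measure)
  have "(\<integral>x. (\<Sum>i\<in>I. c i * indicator (A i) x) \<partial>M) = (\<Sum>i\<in>I. \<integral>x. c i * indicator (A i) x \<partial>M)"
    using I by (intro Bochner_Integration.integral_sum integrable_mult_right integrable_real_indicator)
      (auto simp: emeasure_eq_measure)
  also have "\<dots> = (\<Sum>i\<in>I. measure M (A i) * c i)"
    using I sets.sets_into_space by (intro sum.cong) (auto simp: Int_absorb2)
  finally have eq: "integral\<^sup>L M f - (\<Sum>i\<in>I. measure M (A i) * c i) =
      (\<integral>x. f x - (\<Sum>i\<in>I. c i * indicator (A i) x) \<partial>M)"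
    using int int2 by simp
  have pt: "\<bar>f x - (\<Sum>i\<in>I. c i * indicator (A i) x)\<bar> \<le> e" if x: "x \<in> space M" for x
  proof -
    obtain i where i: "i \<in> I" "x \<in> A i" using x I(4) by blast
    have "(\<Sum>j\<in>I. c j * indicator (A j) x) = (\<Sum>j\<in>{i}. c j * indicator (A j) x)"
      using I i by (intro sum.mono_neutral_right) (auto simp: disjoint_family_on_def indicator_def)
    then show ?thesis using e[OF i] i by simp
  qed
  have "\<bar>\<integral>x. f x - (\<Sum>i\<in>I. c i * indicator (A i) x) \<partial>M\<bar> \<le>
      (\<integral>x. \<bar>f x - (\<Sum>i\<in>I. c i * indicator (A i) x)\<bar> \<partial>M)"
    by (rule integral_abs_bound)
  also have "\<dots> \<le> (\<integral>x. e \<partial>M)"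
    using int int2 pt by (intro integral_mono) auto
  finally show ?thesis using eq by (simp add: mult.commute)
qed

lemma signed_integral_approx_by_partition:
  fixes f :: "'a \<Rightarrow> real"
  assumes \<mu>: "\<mu> \<in> finite_signed_measures M"
    and f: "f \<in> borel_measurable M" and bdd: "\<And>x. x \<in> space M \<Longrightarrow> \<bar>f x\<bar> \<le> B"
    and I: "finite I" "\<And>i. i \<in> I \<Longrightarrow> A i \<in> sets M" "disjoint_family_on A I"
      "(\<Union>i\<in>I. A i) = space M"
    and e: "\<And>i x. i \<in> I \<Longrightarrow> x \<in> A i \<Longrightarrow> \<bar>f x - c i\<bar> \<le> e"
  shows "\<bar>signed_integral M \<mu> f - (\<Sum>i\<in>I. \<mu> (A i) * c i)\<bar> \<le> e * total_variation M \<mu>"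
proof -
  have le: "\<bar>integral\<^sup>L (pos_part M \<nu>) f - (\<Sum>i\<in>I. measure (pos_part M \<nu>) (A i) * c i)\<bar>
      \<le> e * measure (pos_part M \<nu>) (space M)" if \<nu>: "\<nu> \<in> finite_signed_measures M" for \<nu>
    using finite_measure.integral_approx_by_partition[OF finite_measure_pos_part[OF \<nu>], of f B I A c e]
      f bdd I e by (simp add: measurable_def)
  have "(\<Sum>i\<in>I. \<mu> (A i) * c i) = (\<Sum>i\<in>I. measure (pos_part M \<mu>) (A i) * c i)
      - (\<Sum>i\<in>I. measure (pos_part M (- \<mu>)) (A i) * c i)"
    unfolding sum_subtractf[symmetric] using I
    by (intro sum.cong) (auto simp: Jordan_decomposition[OF \<mu>] left_diff_distrib)
  then show ?thesis
    using le[OF \<mu>] le[OF fsm_uminus[OF \<mu>]]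
    unfolding signed_integral_def total_variation_def abs_le_iff distrib_left by linarith
qed

section \<open>Integration over a compact metric space\<close>

text \<open>A tagged Borel partition in which a tag \<open>s i\<close> need only be close to its
  cell, not inside it; cells may be empty.\<close>

definition fine_partition ::
    "'a::metric_space set \<Rightarrow> real \<Rightarrow> nat \<Rightarrow> (nat \<Rightarrow> 'a) \<Rightarrow> (nat \<Rightarrow> 'a set) \<Rightarrow> bool" where
  "fine_partition X e n s A \<longleftrightarrow>
     (\<forall>i<n. s i \<in> X \<and> A i \<in> sets (restrict_space borel X) \<and> (\<forall>x\<in>A i. dist x (s i) < e)) \<and>
     disjoint_family_on A {..<n} \<and> (\<Union>i<n. A i) = X"

lemma fine_partition_exists:
  fixes X :: "'a::metric_space set"
  assumes "compact X" "e > 0"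
  shows "\<exists>n s A. fine_partition X e n s A"
proof -
  obtain C where C: "C \<subseteq> X" "finite C" "X \<subseteq> (\<Union>x\<in>C. ball x e)"
    by (rule compactE_image[OF \<open>compact X\<close>, of X "\<lambda>x. ball x e"]) (use \<open>e > 0\<close> in auto)
  obtain xs where xs: "set xs = C" using finite_list[OF C(2)] by blast
  \<comment> \<open>Subtracting the earlier balls makes the cells disjoint; a point lies in the cell
    of the first ball that contains it.\<close>
  define A where "A i = X \<inter> (ball (xs ! i) e - (\<Union>j<i. ball (xs ! j) e))" for i
  have "A i \<in> sets (restrict_space borel X)" for i
    unfolding A_def sets_restrict_space by (intro imageI sets.Diff sets.finite_UN) auto
  moreover have "disjoint_family_on A {..<length xs}"
    unfolding disjoint_family_on_def
  proof (intro ballI impI)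
    fix i j :: nat assume "i \<noteq> j"
    moreover have "A i \<inter> A j = {}" if "i < j" for i j
      using that by (auto simp: A_def)
    ultimately show "A i \<inter> A j = {}"
      by (metis Int_commute linorder_neqE_nat)
  qed
  moreover have "X \<subseteq> (\<Union>i<length xs. A i)"
  proof
    fix x assume x: "x \<in> X"
    have "\<exists>i. i < length xs \<and> x \<in> ball (xs ! i) e"
      using C(3) x unfolding xs[symmetric] by (metis UN_E in_set_conv_nth subsetD)
    then obtain i where i: "i < length xs" "x \<in> ball (xs ! i) e"
        and least: "\<And>j. j < i \<Longrightarrow> \<not> (j < length xs \<and> x \<in> ball (xs ! j) e)"
      unfolding exists_least_iff[of "\<lambda>i. i < length xs \<and> x \<in> ball (xs ! i) e"] by blast
    have "x \<notin> ball (xs ! j) e" if "j < i" for j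
      using least[OF that] that i(1) by linarith
    then have "x \<in> A i" using x i unfolding A_def by blast
    then show "x \<in> (\<Union>i<length xs. A i)" using i(1) by blast
  qed
  moreover have "A i \<subseteq> X" "\<forall>x\<in>A i. dist x (xs ! i) < e" for i
    by (auto simp: A_def dist_commute)
  moreover have "xs ! i \<in> X" if "i < length xs" for i
    using that xs C(1) nth_mem by blast
  ultimately have "fine_partition X e (length xs) (\<lambda>i. xs ! i) A"
    unfolding fine_partition_def by blast
  then show ?thesis by blast
qed

locale compact_metric =
  fixes X :: "'a::metric_space set"
  assumes compact: "compact X"
begin

abbreviation "\<M> \<equiv> restrict_space borel X"
abbreviation "\<S> \<equiv> signed_borel_measures X"
abbreviation "\<S>\<^sub>0 \<equiv> signed_borel_measures_of_mass 0 X"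
abbreviation "integ \<equiv> signed_integral \<M>"
abbreviation "TV \<equiv> total_variation \<M>"

lemma space_M [simp]: "space \<M> = X"
  by (simp add: space_restrict_space)

text \<open>One sequence of partitions is fixed once and for all and shared by all measures and
  integrands, so that the resulting Riemann sums are exactly linear in both.\<close>

definition "partition_of k = (SOME (n, s, A). fine_partition X (inverse (real (Suc k))) n s A)"
definition "pnum k = fst (partition_of k)"
definition "ptag k = fst (snd (partition_of k))"
definition "pset k = snd (snd (partition_of k))"

lemma fine_partition_pset:
  "fine_partition X (inverse (real (Suc k))) (pnum k) (ptag k) (pset k)"
proof -
  have "\<exists>p. case p of (n, s, A) \<Rightarrow> fine_partition X (inverse (real (Suc k))) n s A"
    using fine_partition_exists[OF compact, of "inverse (real (Suc k))"] by auto
  from someI_ex[OF this] show ?thesis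
    unfolding partition_of_def[symmetric] pnum_def ptag_def pset_def by (simp add: case_prod_beta)
qed

lemma ptag_in: "i < pnum k \<Longrightarrow> ptag k i \<in> X"
  and pset_sets: "i < pnum k \<Longrightarrow> pset k i \<in> sets \<M>"
  and pset_small: "i < pnum k \<Longrightarrow> x \<in> pset k i \<Longrightarrow> dist x (ptag k i) < inverse (real (Suc k))"
  and pset_disjoint: "disjoint_family_on (pset k) {..<pnum k}"
  and pset_cover: "(\<Union>i<pnum k. pset k i) = X"
  using fine_partition_pset[of k] by (auto simp: fine_partition_def)

lemma pset_subset: "i < pnum k \<Longrightarrow> x \<in> pset k i \<Longrightarrow> x \<in> X"
  using pset_cover[of k] by blast

lemma sum_pset: "\<mu> \<in> \<S> \<Longrightarrow> (\<Sum>i<pnum k. \<mu> (pset k i)) = \<mu> X"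
  using fsm_UN[of \<mu> \<M> "{..<pnum k}" "pset k"] pset_sets pset_disjoint pset_cover
  by (simp add: signed_borel_measures_def)

lemma sum_abs_pset: "\<mu> \<in> \<S> \<Longrightarrow> (\<Sum>i<pnum k. \<bar>\<mu> (pset k i)\<bar>) \<le> TV \<mu>"
  unfolding signed_borel_measures_def
  by (rule sum_abs_le_total_variation) (auto intro: pset_sets pset_disjoint)

section \<open>Riemann sums and linearity of the integral\<close>

definition riemann_sum :: "nat \<Rightarrow> ('a set \<Rightarrow> real) \<Rightarrow> ('a \<Rightarrow> real) \<Rightarrow> real" where
  "riemann_sum k \<mu> f = (\<Sum>i<pnum k. \<mu> (pset k i) * f (ptag k i))"

lemma bounded_continuous:
  fixes f :: "'a \<Rightarrow> real"
  assumes "continuous_on X f"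
  obtains B where "\<And>x. x \<in> X \<Longrightarrow> \<bar>f x\<bar> \<le> B"
  using compact_imp_bounded[OF compact_continuous_image[OF assms compact]]
  by (auto simp: bounded_iff)

lemma riemann_sum_error:
  assumes \<mu>: "\<mu> \<in> \<S>" and f: "continuous_on X f"
    and e: "\<And>i x. i < pnum k \<Longrightarrow> x \<in> pset k i \<Longrightarrow> \<bar>f x - f (ptag k i)\<bar> \<le> e"
  shows "\<bar>integ \<mu> f - riemann_sum k \<mu> f\<bar> \<le> e * TV \<mu>"
proof -
  obtain B where B: "\<And>x. x \<in> X \<Longrightarrow> \<bar>f x\<bar> \<le> B" using bounded_continuous[OF f] by blast
  show ?thesis
    unfolding riemann_sum_def
    using \<mu> B e pset_sets pset_disjoint pset_cover borel_measurable_continuous_on_restrict[OF f]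
    by (intro signed_integral_approx_by_partition[where B = B])
      (auto simp: signed_borel_measures_def)
qed

lemma riemann_sum_tendsto:
  assumes \<mu>: "\<mu> \<in> \<S>" and f: "continuous_on X f"
  shows "(\<lambda>k. riemann_sum k \<mu> f) \<longlonglongrightarrow> integ \<mu> f"
proof (rule LIMSEQ_I)
  fix r :: real assume r: "r > 0"
  \<comment> \<open>The added 1 keeps the quotient meaningful when \<open>TV \<mu>\<close> is 0 and
    makes \<open>e * TV \<mu> < r\<close> strict.\<close>
  define e where "e = r / (TV \<mu> + 1)"
  have TV: "0 \<le> TV \<mu>" by (rule total_variation_nonneg)
  then have e: "e > 0" using r by (simp add: e_def)
  have "e * TV \<mu> < r" using r TV by (simp add: e_def field_simps)
  obtain d where d: "d > 0" "\<And>x y. x \<in> X \<Longrightarrow> y \<in> X \<Longrightarrow> dist y x < d \<Longrightarrow> dist (f y) (f x) < e"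
    using compact_uniformly_continuous[OF f compact] e unfolding uniformly_continuous_on_def
    by metis
  obtain K where K: "inverse (real (Suc K)) < d" using reals_Archimedean[OF d(1)] by blast
  have "norm (riemann_sum k \<mu> f - integ \<mu> f) < r" if "k \<ge> K" for k
  proof -
    have "inverse (real (Suc k)) \<le> inverse (real (Suc K))" using that by simp
    then have k: "inverse (real (Suc k)) < d" using K by linarith
    have "\<bar>f x - f (ptag k i)\<bar> \<le> e" if "i < pnum k" "x \<in> pset k i" for i x
      using d(2)[OF ptag_in pset_subset, of i k i k x] less_trans[OF pset_small[OF that] k] that
      by (simp add: dist_real_def)
    then have "\<bar>integ \<mu> f - riemann_sum k \<mu> f\<bar> \<le> e * TV \<mu>"
      by (rule riemann_sum_error[OF \<mu> f])
    then show ?thesis using \<open>e * TV \<mu> < r\<close> by (simp add: abs_minus_commute)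
  qed
  then show "\<exists>K. \<forall>k\<ge>K. norm (riemann_sum k \<mu> f - integ \<mu> f) < r" by blast
qed

text \<open>The positive part does not depend linearly on the measure, so linearity is not visible
  in the definition of the integral. It is inherited from the Riemann sums in the limit.\<close>

lemma integ_lincomb_measure:
  assumes "\<mu> \<in> \<S>" "\<nu> \<in> \<S>" and f: "continuous_on X f"
  shows "integ (\<lambda>A. a * \<mu> A + b * \<nu> A) f = a * integ \<mu> f + b * integ \<nu> f"
proof (rule LIMSEQ_unique)
  show "(\<lambda>k. riemann_sum k (\<lambda>A. a * \<mu> A + b * \<nu> A) f) \<longlonglongrightarrow> integ (\<lambda>A. a * \<mu> A + b * \<nu> A) f"
    using assms by (intro riemann_sum_tendsto) (auto simp: signed_borel_measures_def fsm_lincomb)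
  have "riemann_sum k (\<lambda>A. a * \<mu> A + b * \<nu> A) f = a * riemann_sum k \<mu> f + b * riemann_sum k \<nu> f" for k
    by (simp add: riemann_sum_def sum_distrib_left sum.distrib[symmetric] algebra_simps)
  then show "(\<lambda>k. riemann_sum k (\<lambda>A. a * \<mu> A + b * \<nu> A) f) \<longlonglongrightarrow> a * integ \<mu> f + b * integ \<nu> f"
    using assms by (auto intro!: tendsto_intros riemann_sum_tendsto)
qed

lemma integ_lincomb_fun:
  assumes "\<mu> \<in> \<S>" "continuous_on X f" "continuous_on X g"
  shows "integ \<mu> (\<lambda>x. a * f x + b * g x) = a * integ \<mu> f + b * integ \<mu> g"
proof (rule LIMSEQ_unique)
  show "(\<lambda>k. riemann_sum k \<mu> (\<lambda>x. a * f x + b * g x)) \<longlonglongrightarrow> integ \<mu> (\<lambda>x. a * f x + b * g x)"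
    using assms by (intro riemann_sum_tendsto continuous_intros) auto
  have "riemann_sum k \<mu> (\<lambda>x. a * f x + b * g x) = a * riemann_sum k \<mu> f + b * riemann_sum k \<mu> g" for k
    by (simp add: riemann_sum_def sum_distrib_left sum.distrib[symmetric] algebra_simps)
  then show "(\<lambda>k. riemann_sum k \<mu> (\<lambda>x. a * f x + b * g x)) \<longlonglongrightarrow> a * integ \<mu> f + b * integ \<mu> g"
    using assms by (auto intro!: tendsto_intros riemann_sum_tendsto)
qed

lemma abs_integ_le:
  assumes "\<mu> \<in> \<S>" "continuous_on X f" "\<And>x. x \<in> X \<Longrightarrow> \<bar>f x\<bar> \<le> c"
  shows "\<bar>integ \<mu> f\<bar> \<le> c * TV \<mu>"
proof -
  have X: "X \<in> sets \<M>" using sets.top[of \<M>] by simp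
  show ?thesis
  \<comment> \<open>The partition has the single cell \<open>X\<close>, approximated by the value 0
    with error \<open>c\<close>.\<close>
  using signed_integral_approx_by_partition[of \<mu> \<M> f c "{()}" "\<lambda>_. X" "\<lambda>_. 0" c] assms X
    borel_measurable_continuous_on_restrict[OF assms(2)]
    by (simp add: signed_borel_measures_def disjoint_family_on_def)
qed

section \<open>Potentials, energy and the bilinear form\<close>

definition potential :: "('a set \<Rightarrow> real) \<Rightarrow> 'a \<Rightarrow> real" where
  "potential \<mu> y = integ \<mu> (\<lambda>x. dist x y)"

lemma abs_potential_diff_le:
  assumes "\<mu> \<in> \<S>"
  shows "\<bar>potential \<mu> y - potential \<mu> z\<bar> \<le> dist y z * TV \<mu>"
proof -
  have "potential \<mu> y - potential \<mu> z = integ \<mu> (\<lambda>x. 1 * dist x y + (-1) * dist x z)"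
    unfolding potential_def using assms
    by (subst integ_lincomb_fun) (auto intro!: continuous_intros)
  moreover have "\<bar>integ \<mu> (\<lambda>x. 1 * dist x y + (-1) * dist x z)\<bar> \<le> dist y z * TV \<mu>"
    using assms abs_dist_diff_le[of y _ z]
    by (intro abs_integ_le) (auto intro!: continuous_intros simp: dist_commute)
  ultimately show ?thesis by simp
qed

lemma continuous_on_potential:
  assumes "\<mu> \<in> \<S>" shows "continuous_on Y (potential \<mu>)"
proof -
  have "(TV \<mu>)-lipschitz_on Y (potential \<mu>)"
    using abs_potential_diff_le[OF assms]
    by (intro lipschitz_onI total_variation_nonneg) (simp add: dist_real_def mult.commute)
  then show ?thesis by (rule lipschitz_on_continuous_on)
qed

lemma energy_eq: "energy X \<mu> \<nu> = integ \<nu> (potential \<mu>)"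
  by (simp add: energy_def potential_def[abs_def])

text \<open>Both integrations are discretised over the same tagged partition. Symmetry and
  positivity of the form can then be read off finite double sums, without exchanging
  integrals.\<close>

lemma energy_tendsto:
  assumes \<mu>: "\<mu> \<in> \<S>" and \<nu>: "\<nu> \<in> \<S>"
  shows "(\<lambda>k. \<Sum>i<pnum k. \<Sum>j<pnum k. \<mu> (pset k i) * \<nu> (pset k j) * dist (ptag k i) (ptag k j))
    \<longlonglongrightarrow> energy X \<mu> \<nu>"
proof -
  \<comment> \<open>\<open>?D k\<close> is the double sum with the sum against \<open>\<mu>\<close>
    carried out inside. It differs from the Riemann sum of the exact potential by at most the mesh
    times \<open>TV \<mu>\<close> at each tag, and the weights
    \<open>\<bar>\<nu> (pset k j)\<bar>\<close> add up to at most \<open>TV \<nu>\<close>.\<close>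
  let ?D = "\<lambda>k. \<Sum>j<pnum k. \<nu> (pset k j) * riemann_sum k \<mu> (\<lambda>x. dist x (ptag k j))"
  have D: "(\<Sum>i<pnum k. \<Sum>j<pnum k. \<mu> (pset k i) * \<nu> (pset k j) * dist (ptag k i) (ptag k j)) = ?D k" for k
    unfolding riemann_sum_def sum_distrib_left by (subst sum.swap) (simp add: mult_ac)
  have err: "\<bar>riemann_sum k \<nu> (potential \<mu>) - ?D k\<bar> \<le> inverse (real (Suc k)) * TV \<mu> * TV \<nu>" for k
  proof -
    have "\<bar>riemann_sum k \<nu> (potential \<mu>) - ?D k\<bar> = \<bar>\<Sum>j<pnum k. \<nu> (pset k j) *
        (potential \<mu> (ptag k j) - riemann_sum k \<mu> (\<lambda>x. dist x (ptag k j)))\<bar>"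
      by (simp add: riemann_sum_def[of _ \<nu>] sum_subtractf[symmetric] right_diff_distrib)
    also have "\<dots> \<le> (\<Sum>j<pnum k. \<bar>\<nu> (pset k j)\<bar> * (inverse (real (Suc k)) * TV \<mu>))"
    proof (intro order_trans[OF sum_abs] sum_mono, unfold abs_mult, rule mult_left_mono)
      fix j
      show "\<bar>potential \<mu> (ptag k j) - riemann_sum k \<mu> (\<lambda>x. dist x (ptag k j))\<bar>
          \<le> inverse (real (Suc k)) * TV \<mu>"
        unfolding potential_def
      proof (rule riemann_sum_error[OF \<mu>])
        fix i x assume "i < pnum k" "x \<in> pset k i"
        then show "\<bar>dist x (ptag k j) - dist (ptag k i) (ptag k j)\<bar> \<le> inverse (real (Suc k))"
          using pset_small[of i k x] abs_dist_diff_le[of x "ptag k j" "ptag k i"]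
          by (simp add: dist_commute)
      qed (intro continuous_intros)
    qed simp
    also have "\<dots> \<le> TV \<nu> * (inverse (real (Suc k)) * TV \<mu>)"
      unfolding sum_distrib_right[symmetric]
      by (intro mult_right_mono sum_abs_pset \<nu> mult_nonneg_nonneg total_variation_nonneg) simp
    finally show ?thesis by (simp add: mult_ac)
  qed
  have "(\<lambda>k. inverse (real (Suc k)) * TV \<mu> * TV \<nu>) \<longlonglongrightarrow> 0 * TV \<mu> * TV \<nu>"
    by (intro tendsto_intros LIMSEQ_inverse_real_of_nat)
  then have "(\<lambda>k. riemann_sum k \<nu> (potential \<mu>) - ?D k) \<longlonglongrightarrow> 0"
    unfolding mult_zero_left
    by (rule Lim_null_comparison[rotated]) (rule always_eventually, use err in simp)
  from tendsto_diff[OF riemann_sum_tendsto[OF \<nu> continuous_on_potential[OF \<mu>]] this]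
  show ?thesis by (simp add: D energy_eq)
qed

lemma inner_sym:
  assumes "\<mu> \<in> \<S>" "\<nu> \<in> \<S>" shows "E0_inner X \<mu> \<nu> = E0_inner X \<nu> \<mu>"
proof -
  have "energy X \<mu> \<nu> = energy X \<nu> \<mu>"
  proof (rule LIMSEQ_unique[OF energy_tendsto[OF assms]])
    show "(\<lambda>k. \<Sum>i<pnum k. \<Sum>j<pnum k. \<mu> (pset k i) * \<nu> (pset k j) * dist (ptag k i) (ptag k j))
      \<longlonglongrightarrow> energy X \<nu> \<mu>"
      using energy_tendsto[OF assms(2,1)] by (subst sum.swap) (simp add: mult_ac dist_commute)
  qed
  then show ?thesis by (simp add: E0_inner_def)
qed

lemma inner_lincomb_right:
  assumes "\<mu> \<in> \<S>" "\<nu> \<in> \<S>" "\<rho> \<in> \<S>"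
  shows "E0_inner X \<rho> (\<lambda>A. a * \<mu> A + b * \<nu> A) = a * E0_inner X \<rho> \<mu> + b * E0_inner X \<rho> \<nu>"
  using assms by (simp add: E0_inner_def energy_eq integ_lincomb_measure continuous_on_potential)

lemma lincomb_S: "\<mu> \<in> \<S> \<Longrightarrow> \<nu> \<in> \<S> \<Longrightarrow> (\<lambda>A. a * \<mu> A + b * \<nu> A) \<in> \<S>"
  by (simp add: signed_borel_measures_def fsm_lincomb)

lemma inner_lincomb_left:
  assumes "\<mu> \<in> \<S>" "\<nu> \<in> \<S>" "\<rho> \<in> \<S>"
  shows "E0_inner X (\<lambda>A. a * \<mu> A + b * \<nu> A) \<rho> = a * E0_inner X \<mu> \<rho> + b * E0_inner X \<nu> \<rho>"
  unfolding inner_sym[OF lincomb_S[OF assms(1,2)] assms(3)] inner_sym[OF assms(1,3)]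
    inner_sym[OF assms(2,3)] by (rule inner_lincomb_right[OF assms])

lemma lincomb_S0: "\<mu> \<in> \<S>\<^sub>0 \<Longrightarrow> \<nu> \<in> \<S>\<^sub>0 \<Longrightarrow> (\<lambda>A. a * \<mu> A + b * \<nu> A) \<in> \<S>\<^sub>0"
  by (simp add: signed_borel_measures_of_mass_def lincomb_S)

lemma diff_S0: "\<mu> \<in> \<S>\<^sub>0 \<Longrightarrow> \<nu> \<in> \<S>\<^sub>0 \<Longrightarrow> \<mu> - \<nu> \<in> \<S>\<^sub>0"
  using lincomb_S0[of \<mu> \<nu> 1 "-1"] by (simp add: fun_diff_def)

lemma S0_S: "\<mu> \<in> \<S>\<^sub>0 \<Longrightarrow> \<mu> \<in> \<S>"
  by (simp add: signed_borel_measures_of_mass_def)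

section \<open>Point masses and dipoles\<close>

definition point_mass :: "'a \<Rightarrow> 'a set \<Rightarrow> real" where
  "point_mass x A = (if A \<in> sets \<M> then indicator A x else 0)"

lemma point_mass_S [simp]: "point_mass x \<in> \<S>"
proof -
  have "(\<lambda>i. point_mass x (A i)) sums point_mass x (\<Union>i. A i)"
    if "range A \<subseteq> sets \<M>" "disjoint_family A" for A :: "nat \<Rightarrow> 'a set"
  proof -
    have "(\<lambda>i. indicator (A i) x :: real) sums indicator (\<Union>i. A i) x"
      using that by (intro indicator_sums) (auto simp: disjoint_family_on_def)
    moreover have "A i \<in> sets \<M>" "(\<Union>i. A i) \<in> sets \<M>" for i
      using that by auto
    ultimately show ?thesis by (simp add: point_mass_def)
  qed
  then show ?thesis
    by (auto simp: signed_borel_measures_def finite_signed_measures_def point_mass_def)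
qed

text \<open>Only the cell containing \<open>x\<close> contributes to the Riemann sum, and its tag
  tends to \<open>x\<close> as the mesh shrinks.\<close>

lemma integ_point_mass:
  assumes x: "x \<in> X" and f: "continuous_on X f"
  shows "integ (point_mass x) f = f x"
proof (rule LIMSEQ_unique[OF riemann_sum_tendsto[OF point_mass_S f]])
  have "\<exists>i<pnum k. x \<in> pset k i" for k using pset_cover[of k] x by blast
  then obtain i where i: "\<And>k. i k < pnum k" "\<And>k. x \<in> pset k (i k)" by metis
  have "riemann_sum k (point_mass x) f = f (ptag k (i k))" for k
  proof -
    have "riemann_sum k (point_mass x) f = (\<Sum>j\<in>{i k}. point_mass x (pset k j) * f (ptag k j))"
      unfolding riemann_sum_def using i[of k] pset_disjoint[of k]
      by (intro sum.mono_neutral_right) (auto simp: point_mass_def disjoint_family_on_def indicator_def)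
    then show ?thesis using i pset_sets[of "i k" k] by (simp add: point_mass_def)
  qed
  moreover have "(\<lambda>k. f (ptag k (i k))) \<longlonglongrightarrow> f x"
  proof (rule continuous_on_tendsto_compose[OF f _ x])
    have "(\<lambda>k. dist (ptag k (i k)) x) \<longlonglongrightarrow> 0"
      using pset_small[OF i]
      by (intro Lim_null_comparison[OF _ LIMSEQ_inverse_real_of_nat])
        (auto simp: dist_commute less_imp_le)
    then show "(\<lambda>k. ptag k (i k)) \<longlonglongrightarrow> x" by (rule tendsto_dist_iff[THEN iffD2])
  qed (use ptag_in i in auto)
  ultimately show "(\<lambda>k. riemann_sum k (point_mass x) f) \<longlonglongrightarrow> f x" by simp
qed

text \<open>The explicit coefficients 1 and -1 put the difference into the shape of the linear
  combination lemmas.\<close>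

definition dipole :: "'a \<Rightarrow> 'a \<Rightarrow> 'a set \<Rightarrow> real" where
  "dipole x y = (\<lambda>A. 1 * point_mass x A + (-1) * point_mass y A)"

lemma dipole_S0:
  assumes "x \<in> X" "y \<in> X" shows "dipole x y \<in> \<S>\<^sub>0"
proof -
  have "dipole x y \<in> \<S>"
    unfolding dipole_def by (intro lincomb_S point_mass_S)
  then show ?thesis
    using assms sets.top[of \<M>]
    by (simp add: signed_borel_measures_of_mass_def dipole_def point_mass_def)
qed

lemma inner_dipole_right:
  assumes "\<mu> \<in> \<S>" "x \<in> X" "y \<in> X"
  shows "E0_inner X \<mu> (dipole x y) = potential \<mu> y - potential \<mu> x"
  unfolding dipole_def using assms
  by (subst inner_lincomb_right)
    (auto simp: E0_inner_def energy_eq integ_point_mass continuous_on_potential)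

lemma potential_dipole:
  assumes "x \<in> X" "y \<in> X"
  shows "potential (dipole x y) z = dist x z - dist y z"
proof -
  have "continuous_on X (\<lambda>x. dist x z)" by (intro continuous_intros)
  then show ?thesis
    unfolding potential_def dipole_def using assms
    by (subst integ_lincomb_measure) (auto simp: integ_point_mass)
qed

end

section \<open>The semi-inner product space\<close>

locale compact_quasihypermetric = compact_metric +
  assumes quasihypermetric: "quasihypermetric X"
begin

abbreviation "nrm \<equiv> E0_seminorm X"

text \<open>The cell masses, placed at the tags, are weights of sum \<open>\<mu> X = 0\<close>, so
  the quasihypermetric inequality applies to every discretised energy and survives the
  limit.\<close>

lemma inner_nonneg:
  assumes "\<mu> \<in> \<S>\<^sub>0" shows "0 \<le> E0_inner X \<mu> \<mu>"
proof -
  have "\<mu> X = 0" using assms by (simp add: signed_borel_measures_of_mass_def)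
  then have "(\<Sum>i<pnum k. \<Sum>j<pnum k. \<mu> (pset k i) * \<mu> (pset k j) * dist (ptag k i) (ptag k j)) \<le> 0" for k
    using quasihypermetric sum_pset[OF S0_S[OF assms]] ptag_in
    unfolding quasihypermetric_def by auto
  then have "energy X \<mu> \<mu> \<le> 0"
    by (intro LIMSEQ_le_const2[OF energy_tendsto[OF S0_S[OF assms] S0_S[OF assms]]]) auto
  then show ?thesis by (simp add: E0_inner_def)
qed

lemma nrm_nonneg: "\<mu> \<in> \<S>\<^sub>0 \<Longrightarrow> 0 \<le> nrm \<mu>"
  by (simp add: E0_seminorm_def inner_nonneg)

lemma nrm_sq: "\<mu> \<in> \<S>\<^sub>0 \<Longrightarrow> (nrm \<mu>)\<^sup>2 = E0_inner X \<mu> \<mu>"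
  by (simp add: E0_seminorm_def inner_nonneg)

lemma inner_lincomb_self:
  assumes "\<mu> \<in> \<S>\<^sub>0" "\<nu> \<in> \<S>\<^sub>0"
  shows "E0_inner X (\<lambda>A. a * \<mu> A + b * \<nu> A) (\<lambda>A. a * \<mu> A + b * \<nu> A) =
    a\<^sup>2 * E0_inner X \<mu> \<mu> + 2 * a * b * E0_inner X \<mu> \<nu> + b\<^sup>2 * E0_inner X \<nu> \<nu>"
  using assms[THEN S0_S] inner_sym[of \<mu> \<nu>]
  by (simp add: inner_lincomb_left inner_lincomb_right lincomb_S power2_eq_square algebra_simps)

lemma Cauchy_Schwarz:
  assumes \<mu>: "\<mu> \<in> \<S>\<^sub>0" and \<nu>: "\<nu> \<in> \<S>\<^sub>0"
  shows "\<bar>E0_inner X \<mu> \<nu>\<bar> \<le> nrm \<mu> * nrm \<nu>"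
proof -
  define a b c where "a = E0_inner X \<mu> \<mu>" and "b = E0_inner X \<mu> \<nu>" and "c = E0_inner X \<nu> \<nu>"
  have quad: "0 \<le> a + 2 * t * b + t\<^sup>2 * c" for t
    using inner_nonneg[OF lincomb_S0[OF assms, of 1 t]] inner_lincomb_self[OF assms, of 1 t]
    by (simp add: a_def b_def c_def)
  have ac: "a \<ge> 0" "c \<ge> 0" using assms by (auto simp: a_def c_def inner_nonneg)
  have "b\<^sup>2 \<le> a * c"
  \<comment> \<open>The form may be degenerate. If \<open>c = 0\<close>, the quadratic is affine in
    \<open>t\<close> and stays nonnegative only if \<open>b = 0\<close>; the value of
    \<open>t\<close> used below would make it -1. Otherwise \<open>t = - b / c\<close> minimises
    it.\<close>
  proof (cases "c = 0")
    case True
    have "b = 0"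
    proof (rule ccontr)
      assume "b \<noteq> 0"
      then show False using quad[of "- (a + 1) / (2 * b)"] True by (simp add: field_simps)
    qed
    then show ?thesis using True by simp
  next
    case False
    then have "c > 0" using ac by simp
    have "a + 2 * (- b / c) * b + (- b / c)\<^sup>2 * c = a - b\<^sup>2 / c"
      using False by (simp add: power2_eq_square field_simps)
    then have "b\<^sup>2 / c \<le> a" using quad[of "- b / c"] by linarith
    then show ?thesis using \<open>c > 0\<close> by (simp add: pos_divide_le_eq)
  qed
  then have "b\<^sup>2 \<le> (nrm \<mu> * nrm \<nu>)\<^sup>2"
    using assms by (simp add: power_mult_distrib nrm_sq a_def c_def)
  then have "\<bar>b\<bar> \<le> nrm \<mu> * nrm \<nu>"
    using abs_le_square_iff[of b "nrm \<mu> * nrm \<nu>"] assms by (simp add: nrm_nonneg)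
  then show ?thesis by (simp add: b_def)
qed

text \<open>Triangle inequality and scaling in one statement; the choice \<open>a = b = 0\<close>
  also bounds the seminorm of the zero measure by 0.\<close>

lemma nrm_lincomb_le:
  assumes \<mu>: "\<mu> \<in> \<S>\<^sub>0" and \<nu>: "\<nu> \<in> \<S>\<^sub>0"
  shows "nrm (\<lambda>A. a * \<mu> A + b * \<nu> A) \<le> \<bar>a\<bar> * nrm \<mu> + \<bar>b\<bar> * nrm \<nu>"
proof (rule power2_le_imp_le)
  have "a * b * E0_inner X \<mu> \<nu> \<le> \<bar>a * b\<bar> * \<bar>E0_inner X \<mu> \<nu>\<bar>"
    by (metis abs_ge_self abs_mult)
  also have "\<dots> \<le> \<bar>a * b\<bar> * (nrm \<mu> * nrm \<nu>)"
    by (intro mult_left_mono Cauchy_Schwarz assms) simp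
  finally show "(nrm (\<lambda>A. a * \<mu> A + b * \<nu> A))\<^sup>2 \<le> (\<bar>a\<bar> * nrm \<mu> + \<bar>b\<bar> * nrm \<nu>)\<^sup>2"
    using assms
    by (simp add: nrm_sq[OF lincomb_S0] inner_lincomb_self power2_sum power_mult_distrib nrm_sq[symmetric]
      abs_mult mult_ac)
qed (use assms in \<open>simp add: nrm_nonneg\<close>)

lemma nrm_minus_commute:
  assumes "\<mu> \<in> \<S>\<^sub>0" "\<nu> \<in> \<S>\<^sub>0" shows "nrm (\<mu> - \<nu>) = nrm (\<nu> - \<mu>)"
proof -
  have "nrm (\<nu> - \<mu>) \<le> nrm (\<mu> - \<nu>)" if "\<mu> \<in> \<S>\<^sub>0" "\<nu> \<in> \<S>\<^sub>0" for \<mu> \<nu>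
    using nrm_lincomb_le[OF diff_S0[OF that] diff_S0[OF that], of "-1" 0]
    by (simp add: fun_diff_def)
  then show ?thesis using assms by (simp add: antisym)
qed

section \<open>Incompleteness over an infinite space\<close>

lemma infinite_imp_not_complete:
  assumes inf: "infinite X" shows "\<not> E0_complete X"
proof
  assume complete: "E0_complete X"
  obtain y where y: "y \<in> X" "y islimpt X"
    using compact inf unfolding compact_eq_Bolzano_Weierstrass by blast
  \<comment> \<open>With this rate \<open>nrm (u k) = sqrt (2 * d k)\<close> is at most
    \<open>(1/4) ^ k\<close>, so the growing weights \<open>2 ^ k\<close> still leave summable terms
    of size \<open>(1/2) ^ k\<close>.\<close>
  have "0 < (1/16) ^ k / (2::real)" for k :: nat by simp
  then have "\<forall>k::nat. \<exists>x. x \<in> X \<and> x \<noteq> y \<and> dist x y < (1/16) ^ k / 2"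
    using y(2) unfolding islimpt_approachable by blast
  from choice[OF this] obtain x
    where x: "\<And>k::nat. x k \<in> X" "\<And>k. x k \<noteq> y" "\<And>k. dist (x k) y < (1/16) ^ k / 2"
    by blast
  define d where "d k = dist (x k) y" for k
  have d: "d k > 0" "2 * d k < (1/16) ^ k" for k using x(2,3)[of k] by (auto simp: d_def)
  define u where "u k = dipole (x k) y" for k
  have u: "u k \<in> \<S>\<^sub>0" for k using x y by (simp add: u_def dipole_S0)
  have uu: "E0_inner X (u k) (u j) = d k + d j - dist (x k) (x j)" for k j
    using x y S0_S[OF u]
    by (simp add: u_def inner_dipole_right potential_dipole d_def dist_commute)
  have uu_nonneg: "E0_inner X (u k) (u j) \<ge> 0" for k j
    using dist_triangle2[of "x k" "x j" y] by (simp add: uu d_def dist_commute)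
  have nrm_u: "nrm (u k) \<le> (1/4) ^ k" for k
  proof -
    have "nrm (u k) = sqrt (2 * d k)" by (simp add: E0_seminorm_def uu)
    also have "\<dots> \<le> sqrt ((1/16) ^ k)" using d(2)[of k] by simp
    also have "\<dots> = (1/4) ^ k"
      by (simp add: real_sqrt_power real_sqrt_divide)
    finally show ?thesis .
  qed
  define \<sigma> where "\<sigma> K = (\<lambda>A. \<Sum>k<K. 2 ^ k * u k A)" for K
  have \<sigma>_Suc: "\<sigma> (Suc K) = (\<lambda>A. 1 * \<sigma> K A + 2 ^ K * u K A)" for K
    by (simp add: \<sigma>_def)
  have \<sigma>: "\<sigma> K \<in> \<S>\<^sub>0" for K
  proof (induction K)
    case 0
    then show ?case using lincomb_S0[OF u[of 0] u[of 0], of 0 0] by (simp add: \<sigma>_def)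
  next
    case (Suc K)
    then show ?case unfolding \<sigma>_Suc by (intro lincomb_S0 u)
  qed
  have inner_\<sigma>: "E0_inner X (\<sigma> K) (u j) = (\<Sum>k<K. 2 ^ k * E0_inner X (u k) (u j))" for K j
  proof (induction K)
    case 0
    show ?case using inner_lincomb_left[OF S0_S[OF u[of 0]] S0_S[OF u[of 0]] S0_S[OF u[of j]], of 0 0]
      by (simp add: \<sigma>_def)
  next
    case (Suc K)
    then show ?case unfolding \<sigma>_Suc
      by (subst inner_lincomb_left) (auto intro: S0_S u \<sigma>)
  qed
  \<comment> \<open>The right-hand side is the geometric sum of \<open>(1/2) ^ k\<close> over
    \<open>n \<le> k < m\<close>, in closed form for the induction on \<open>m\<close>.\<close>
  have \<sigma>_diff: "nrm (\<sigma> m - \<sigma> n) \<le> 2 * (1/2) ^ n - 2 * (1/2) ^ m" if "n \<le> m" for m n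
    using that
  proof (induction m rule: dec_induct)
    case base
    show ?case using nrm_lincomb_le[OF \<sigma>[of n] \<sigma>[of n], of 0 0] by (simp add: fun_diff_def)
  next
    case (step m)
    have "\<sigma> (Suc m) - \<sigma> n = (\<lambda>A. 1 * (\<sigma> m - \<sigma> n) A + 2 ^ m * u m A)"
      unfolding \<sigma>_Suc by (auto simp: fun_diff_def)
    then have "nrm (\<sigma> (Suc m) - \<sigma> n) \<le> nrm (\<sigma> m - \<sigma> n) + 2 ^ m * nrm (u m)"
      using nrm_lincomb_le[OF diff_S0[OF \<sigma>[of m] \<sigma>[of n]] u[of m], of 1 "2 ^ m"] by simp
    also have "2 ^ m * nrm (u m) \<le> 2 ^ m * (1/4) ^ m" using nrm_u by simp
    also have "\<dots> = (1/2) ^ m" by (simp add: power_mult_distrib[symmetric])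
    finally show ?case using step by simp
  qed
  have "\<exists>N. \<forall>m\<ge>N. \<forall>n\<ge>N. nrm (\<sigma> m - \<sigma> n) < \<epsilon>" if "\<epsilon> > 0" for \<epsilon>
  proof -
    obtain N where N: "(1/2) ^ N < \<epsilon> / 2" using real_arch_pow_inv[of "\<epsilon>/2" "1/2"] \<open>\<epsilon> > 0\<close> by auto
    have *: "nrm (\<sigma> m - \<sigma> n) < \<epsilon>" if "n \<ge> N" "m \<ge> n" for m n
    proof -
      have "nrm (\<sigma> m - \<sigma> n) \<le> 2 * (1/2) ^ n"
        using \<sigma>_diff[OF that(2)] by (smt (verit) zero_le_power divide_nonneg_nonneg)
      also have "\<dots> \<le> 2 * (1/2) ^ N" using that by (simp add: power_decreasing)
      finally show ?thesis using N by simp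
    qed
    have "nrm (\<sigma> m - \<sigma> n) < \<epsilon>" if "n \<ge> N" "m \<ge> N" for m n
      using *[of m n] *[of n m] that nrm_minus_commute[OF \<sigma> \<sigma>, of m n] by (cases "m \<ge> n") auto
    then show ?thesis by blast
  qed
  then obtain v where v: "v \<in> \<S>\<^sub>0" "(\<lambda>n. nrm (\<sigma> n - v)) \<longlonglongrightarrow> 0"
    using complete[unfolded E0_complete_def seminorm_complete_def, rule_format, of \<sigma>] \<sigma> by blast
  have "2 ^ j * 2 \<le> TV v" for j
  proof -
    \<comment> \<open>By Cauchy-Schwarz, pairing with \<open>u j\<close> is continuous for the
      seminorm, so it passes to the limit \<open>v\<close>.\<close>
    have "(\<lambda>K. E0_inner X (\<sigma> K) (u j) - E0_inner X v (u j)) \<longlonglongrightarrow> 0"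
    proof (rule Lim_null_comparison)
      show "\<forall>\<^sub>F K in sequentially. norm (E0_inner X (\<sigma> K) (u j) - E0_inner X v (u j))
          \<le> nrm (\<sigma> K - v) * nrm (u j)"
      proof (rule always_eventually, rule allI)
        fix K
        have "E0_inner X (\<sigma> K) (u j) - E0_inner X v (u j) = E0_inner X (\<sigma> K - v) (u j)"
          using inner_lincomb_left[OF S0_S[OF \<sigma>[of K]] S0_S[OF v(1)] S0_S[OF u[of j]], of 1 "-1"]
          by (simp add: fun_diff_def)
        then show "norm (E0_inner X (\<sigma> K) (u j) - E0_inner X v (u j)) \<le> nrm (\<sigma> K - v) * nrm (u j)"
          using Cauchy_Schwarz[OF diff_S0[OF \<sigma> v(1)] u] by simp
      qed
      show "(\<lambda>K. nrm (\<sigma> K - v) * nrm (u j)) \<longlonglongrightarrow> 0"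
        using v(2) by (rule tendsto_mult_left_zero)
    qed
    then have lim: "(\<lambda>K. E0_inner X (\<sigma> K) (u j)) \<longlonglongrightarrow> E0_inner X v (u j)"
      by (simp add: LIM_zero_iff)
    \<comment> \<open>All terms of \<open>inner_\<sigma>\<close> are nonnegative, so the sum
      dominates its term \<open>k = j\<close>, present once \<open>K > j\<close>.\<close>
    have "2 ^ j * (2 * d j) \<le> E0_inner X (\<sigma> K) (u j)" if "K > j" for K
    proof -
      have "2 ^ j * (2 * d j) = 2 ^ j * E0_inner X (u j) (u j)" by (simp add: uu)
      also have "\<dots> \<le> E0_inner X (\<sigma> K) (u j)"
        unfolding inner_\<sigma> using that uu_nonneg by (intro member_le_sum) auto
      finally show ?thesis .
    qed
    then have "2 ^ j * (2 * d j) \<le> E0_inner X v (u j)"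
      by (intro LIMSEQ_le_const[OF lim] exI[of _ "Suc j"]) auto
    also have "\<dots> = potential v y - potential v (x j)"
      using x y S0_S[OF v(1)] by (simp add: u_def inner_dipole_right)
    also have "\<dots> \<le> d j * TV v"
      using abs_potential_diff_le[OF S0_S[OF v(1)], of y "x j"] by (simp add: d_def dist_commute)
    finally show ?thesis using d(1)[of j] by (simp add: mult_ac)
  qed
  moreover obtain j where "TV v < 2 ^ j" using real_arch_pow[of 2 "TV v"] by auto
  ultimately show False
    by (smt (verit) zero_le_power)
qed

end

section \<open>Finite-dimensional seminormed spaces\<close>

text \<open>Induction on the support: adjoining a coordinate \<open>b\<close>, either the unit vector \<open>e\<close> at \<open>b\<close> has
  positive distance from the old subspace, so the \<open>b\<close>-coordinates of a Cauchy sequence are Cauchy,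
  or, the old subspace being complete, \<open>e\<close> may be replaced by a vector of that subspace.\<close>

lemma finite_support_seminorm_complete:
  fixes q :: "('a \<Rightarrow> real) \<Rightarrow> real"
  assumes lincomb: "\<And>f g a b. q (\<lambda>x. a * f x + b * g x) \<le> \<bar>a\<bar> * q f + \<bar>b\<bar> * q g"
    and nonneg: "\<And>f. 0 \<le> q f"
    and S: "finite S"
    and supp: "\<And>n x. x \<notin> S \<Longrightarrow> F n x = 0"
    and Cauchy: "\<And>\<epsilon>. \<epsilon> > 0 \<Longrightarrow> \<exists>N::nat. \<forall>m\<ge>N. \<forall>n\<ge>N. q (\<lambda>x. F m x - F n x) < \<epsilon>"
  shows "\<exists>g. (\<forall>x. x \<notin> S \<longrightarrow> g x = 0) \<and> (\<lambda>n. q (\<lambda>x. F n x - g x)) \<longlonglongrightarrow> 0"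
proof -
  \<comment> \<open>A form of \<open>lincomb\<close> that needs the linear combination only
    pointwise, so each use reduces to arithmetic at \<open>x\<close>.\<close>
  have le: "q h \<le> \<bar>a\<bar> * q f + \<bar>b\<bar> * q g" if "\<And>x. h x = a * f x + b * g x" for h f g a b
    using lincomb[of a f b g] that by presburger
  show ?thesis
    using S supp Cauchy
  proof (induction S arbitrary: F)
    case empty
    then have "(\<lambda>x. F n x - 0) = (\<lambda>x. 0)" for n by simp
    moreover have "q (\<lambda>x. 0) = 0"
      using lincomb[of 0 "\<lambda>_. 0" 0 "\<lambda>_. 0"] nonneg[of "\<lambda>_. 0"] by simp
    ultimately show ?case by (intro exI[of _ "\<lambda>_. 0"]) simp
  next
    case (insert b S F)
    define e where "e = (\<lambda>x. if x = b then 1 else 0 :: real)"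
    define t where "t n = F n b" for n
    define G where "G n = (\<lambda>x. F n x - t n * e x)" for n
    have G: "G n x = 0" if "x \<notin> S" for n x
      using insert.prems(1)[of x n] that by (auto simp: G_def t_def e_def)
    show ?case
    \<comment> \<open>The cases ask whether \<open>e\<close> is at distance 0 from the functions
      supported in \<open>S\<close>. If so, approximants \<open>W n\<close> of \<open>e\<close> form
      a Cauchy sequence there, and the induction hypothesis yields \<open>w\<close> with
      \<open>q (e - w) = 0\<close>.\<close>
    proof (cases "\<forall>\<delta>>0. \<exists>w. (\<forall>x. x \<notin> S \<longrightarrow> w x = 0) \<and> q (\<lambda>x. e x - w x) < \<delta>")
      case True
      then have "\<forall>n::nat. \<exists>w. (\<forall>x. x \<notin> S \<longrightarrow> w x = 0) \<and> q (\<lambda>x. e x - w x) < inverse (real (Suc n))"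
        by (meson inverse_positive_iff_positive of_nat_0_less_iff zero_less_Suc)
      from choice[OF this] obtain W where W: "\<And>n x. x \<notin> S \<Longrightarrow> W n x = 0"
        "\<And>n. q (\<lambda>x. e x - W n x) < inverse (real (Suc n))" by blast
      have W_lim: "(\<lambda>n. q (\<lambda>x. e x - W n x)) \<longlonglongrightarrow> 0"
        by (rule Lim_null_comparison[OF _ LIMSEQ_inverse_real_of_nat], rule always_eventually)
          (use W(2) nonneg in \<open>simp add: less_imp_le del: of_nat_Suc\<close>)
      have W_diff: "q (\<lambda>x. W m x - W n x) \<le> q (\<lambda>x. e x - W m x) + q (\<lambda>x. e x - W n x)" for m n
        using le[of "\<lambda>x. W m x - W n x" "-1" "\<lambda>x. e x - W m x" 1 "\<lambda>x. e x - W n x"] by simp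
      have "\<exists>N. \<forall>m\<ge>N. \<forall>n\<ge>N. q (\<lambda>x. W m x - W n x) < \<epsilon>" if "\<epsilon> > 0" for \<epsilon>
      proof -
        obtain N where N: "\<And>n. n \<ge> N \<Longrightarrow> norm (q (\<lambda>x. e x - W n x) - 0) < \<epsilon> / 2"
          using LIMSEQ_D[OF W_lim, of "\<epsilon> / 2"] \<open>\<epsilon> > 0\<close> by auto
        have "q (\<lambda>x. W m x - W n x) < \<epsilon>" if "m \<ge> N" "n \<ge> N" for m n
          using W_diff[of m n] N[OF that(1)] N[OF that(2)] by simp
        then show ?thesis by blast
      qed
      from insert.IH[OF W(1) this] obtain w where w: "\<And>x. x \<notin> S \<Longrightarrow> w x = 0"
        "(\<lambda>n. q (\<lambda>x. W n x - w x)) \<longlonglongrightarrow> 0" by blast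
      have "q (\<lambda>x. e x - w x) \<le> q (\<lambda>x. e x - W n x) + q (\<lambda>x. W n x - w x)" for n
        using le[of "\<lambda>x. e x - w x" 1 "\<lambda>x. e x - W n x" 1 "\<lambda>x. W n x - w x"] by simp
      then have "q (\<lambda>x. e x - w x) \<le> 0 + 0"
        by (intro LIMSEQ_le_const[OF tendsto_add[OF W_lim w(2)]]) blast
      then have ew: "q (\<lambda>x. e x - w x) = 0" using nonneg[of "\<lambda>x. e x - w x"] by simp
      \<comment> \<open>Replacing \<open>e\<close> by \<open>w\<close> in \<open>F n\<close> gives a
        sequence supported in \<open>S\<close>; the change is a multiple of \<open>e - w\<close>,
        invisible to \<open>q\<close>.\<close>
      define H where "H n = (\<lambda>x. G n x + t n * w x)" for n
      have H: "H n x = 0" if "x \<notin> S" for n x using that G w(1) by (simp add: H_def)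
      have FH: "F n x - H n x = t n * (e x - w x)" for n x
        by (simp add: H_def G_def algebra_simps)
      have HF: "q (\<lambda>x. H m x - H n x) \<le> q (\<lambda>x. F m x - F n x)" for m n
        using le[of "\<lambda>x. H m x - H n x" 1 "\<lambda>x. F m x - F n x" "t n - t m" "\<lambda>x. e x - w x"]
        by (simp add: ew H_def G_def algebra_simps)
      have "\<exists>N. \<forall>m\<ge>N. \<forall>n\<ge>N. q (\<lambda>x. H m x - H n x) < \<epsilon>" if "\<epsilon> > 0" for \<epsilon>
        using insert.prems(2)[OF that] HF le_less_trans by blast
      from insert.IH[OF H this] obtain g where g: "\<And>x. x \<notin> S \<Longrightarrow> g x = 0"
        "(\<lambda>n. q (\<lambda>x. H n x - g x)) \<longlonglongrightarrow> 0" by blast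
      have "q (\<lambda>x. F n x - g x) \<le> q (\<lambda>x. H n x - g x)" for n
        using le[of "\<lambda>x. F n x - g x" 1 "\<lambda>x. H n x - g x" "t n" "\<lambda>x. e x - w x"] FH
        by (simp add: ew algebra_simps)
      then have "(\<lambda>n. q (\<lambda>x. F n x - g x)) \<longlonglongrightarrow> 0"
        using nonneg by (intro Lim_null_comparison[OF always_eventually g(2)]) simp
      then show ?thesis using g(1) by blast
    next
      case False
      then obtain \<delta> where \<delta>: "\<delta> > 0"
        "\<And>w. (\<And>x. x \<notin> S \<Longrightarrow> w x = 0) \<Longrightarrow> \<delta> \<le> q (\<lambda>x. e x - w x)"
        by (meson not_less)
      have t_le: "\<bar>t m - t n\<bar> * \<delta> \<le> q (\<lambda>x. F m x - F n x)" for m n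
      proof (cases "t m = t n")
        case True
        then show ?thesis by (simp add: nonneg)
      next
        case False
        define s where "s = t m - t n"
        have s: "s \<noteq> 0" using False by (simp add: s_def)
        \<comment> \<open>Dividing \<open>F m - F n = (G m - G n) + s * e\<close> by
          \<open>s\<close> exhibits it as \<open>e\<close> minus a function supported in
          \<open>S\<close>, to which the lower bound \<open>\<delta>\<close> applies.\<close>
        have "\<delta> \<le> q (\<lambda>x. e x - (G n x - G m x) / s)"
          by (rule \<delta>(2)) (simp add: G)
        also have "\<dots> \<le> \<bar>1 / s\<bar> * q (\<lambda>x. F m x - F n x) + \<bar>0\<bar> * q e"
          by (rule le) (use s in \<open>simp add: G_def s_def field_simps\<close>)
        finally show ?thesis using s by (simp add: s_def field_simps)
      qed
      have "Cauchy t"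
      proof (rule CauchyI)
        fix \<epsilon> :: real assume "\<epsilon> > 0"
        then obtain N where N: "\<forall>m\<ge>N. \<forall>n\<ge>N. q (\<lambda>x. F m x - F n x) < \<epsilon> * \<delta>"
          using insert.prems(2)[of "\<epsilon> * \<delta>"] \<delta>(1) by auto
        have "norm (t m - t n) < \<epsilon>" if "m \<ge> N" "n \<ge> N" for m n
          using le_less_trans[OF t_le] N that \<delta>(1) by (metis mult_less_cancel_right_pos real_norm_def)
        then show "\<exists>N. \<forall>m\<ge>N. \<forall>n\<ge>N. norm (t m - t n) < \<epsilon>" by blast
      qed
      then obtain T where T: "t \<longlonglongrightarrow> T" using Cauchy_convergent convergentD by blast
      \<comment> \<open>Since \<open>G m - G n\<close> is \<open>F m - F n\<close> minus
        \<open>(t m - t n) * e\<close>, \<open>t_le\<close> makes the projection \<open>F n\<close>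
        to \<open>G n\<close> bounded with this constant, so \<open>G\<close> is again
        Cauchy.\<close>
      define K where "K = 1 + q e / \<delta>"
      have K: "K > 0" using nonneg[of e] \<delta>(1) by (simp add: K_def add_pos_nonneg)
      have GF: "q (\<lambda>x. G m x - G n x) \<le> K * q (\<lambda>x. F m x - F n x)" for m n
      proof -
        have "q (\<lambda>x. G m x - G n x) \<le> \<bar>1\<bar> * q (\<lambda>x. F m x - F n x) + \<bar>t n - t m\<bar> * q e"
          by (rule le) (simp add: G_def algebra_simps)
        moreover have "\<bar>t n - t m\<bar> * q e \<le> q (\<lambda>x. F m x - F n x) / \<delta> * q e"
          using t_le[of m n] \<delta>(1) by (intro mult_right_mono nonneg) (simp add: pos_le_divide_eq abs_minus_commute)
        ultimately show ?thesis by (simp add: K_def algebra_simps)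
      qed
      have "\<exists>N. \<forall>m\<ge>N. \<forall>n\<ge>N. q (\<lambda>x. G m x - G n x) < \<epsilon>" if "\<epsilon> > 0" for \<epsilon>
      proof -
        obtain N where N: "\<forall>m\<ge>N. \<forall>n\<ge>N. q (\<lambda>x. F m x - F n x) < \<epsilon> / K"
          using insert.prems(2)[of "\<epsilon> / K"] \<open>\<epsilon> > 0\<close> K by auto
        have "q (\<lambda>x. G m x - G n x) < \<epsilon>" if "m \<ge> N" "n \<ge> N" for m n
          proof -
          have "q (\<lambda>x. F m x - F n x) < \<epsilon> / K" using N that by blast
          then show ?thesis using GF[of m n] K by (simp add: pos_less_divide_eq mult.commute)
        qed
        then show ?thesis by blast
      qed
      from insert.IH[OF G this] obtain g where g: "\<And>x. x \<notin> S \<Longrightarrow> g x = 0"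
        "(\<lambda>n. q (\<lambda>x. G n x - g x)) \<longlonglongrightarrow> 0" by blast
      define h where "h = (\<lambda>x. g x + T * e x)"
      have "q (\<lambda>x. F n x - h x) \<le> \<bar>1\<bar> * q (\<lambda>x. G n x - g x) + \<bar>t n - T\<bar> * q e" for n
        by (rule le) (simp add: G_def h_def algebra_simps)
      moreover have "(\<lambda>n. \<bar>1\<bar> * q (\<lambda>x. G n x - g x) + \<bar>t n - T\<bar> * q e) \<longlonglongrightarrow> \<bar>1\<bar> * 0 + \<bar>T - T\<bar> * q e"
        by (intro tendsto_intros g T)
      ultimately have "(\<lambda>n. q (\<lambda>x. F n x - h x)) \<longlonglongrightarrow> 0"
        using nonneg by (intro Lim_null_comparison[where f = "\<lambda>n. q (\<lambda>x. F n x - h x)"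
            and g = "\<lambda>n. \<bar>1\<bar> * q (\<lambda>x. G n x - g x) + \<bar>t n - T\<bar> * q e", OF always_eventually]) simp_all
      moreover have "h x = 0" if "x \<notin> insert b S" for x
        using that g(1) by (simp add: h_def e_def)
      ultimately show ?thesis by blast
    qed
  qed
qed

section \<open>Completeness over a finite space\<close>

context compact_quasihypermetric
begin

text \<open>Coefficient functions on \<open>X\<close> parametrise the mass-zero measures through
  dipoles with a common base point, and pulling the seminorm back along this map reduces the claim
  to functions of finite support.\<close>

lemma finite_imp_complete:
  assumes fin: "finite X" shows "E0_complete X"
  unfolding E0_complete_def seminorm_complete_def
proof (intro allI impI)
  fix \<sigma> :: "nat \<Rightarrow> 'a set \<Rightarrow> real"
  assume \<sigma>: "range \<sigma> \<subseteq> \<S>\<^sub>0"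
    and Cauchy: "\<forall>\<epsilon>>0. \<exists>N. \<forall>m\<ge>N. \<forall>n\<ge>N. nrm (\<sigma> m - \<sigma> n) < \<epsilon>"
  \<comment> \<open>\<open>X\<close> may be empty, so membership of the base point is available only
    in the presence of some \<open>x \<in> X\<close>.\<close>
  define y where "y = (SOME y. y \<in> X)"
  have y: "y \<in> X" if "x \<in> X" for x using that unfolding y_def by (rule someI)
  define \<Phi> where "\<Phi> f = (\<lambda>A. \<Sum>x\<in>X. f x * dipole x y A)" for f
  have sum_S0: "(\<lambda>A. \<Sum>x\<in>Y. f x * dipole x y A) \<in> \<S>\<^sub>0" if "Y \<subseteq> X" for f Y
    using finite_subset[OF that fin] that
  proof (induction Y)
    case empty
    show ?case
      by (simp add: signed_borel_measures_of_mass_def signed_borel_measures_def finite_signed_measures_def)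
  next
    case (insert x Y)
    then show ?case
      using lincomb_S0[OF dipole_S0 insert.IH, of x y "f x" 1] y[of x] by simp
  qed
  have \<Phi>_S0: "\<Phi> f \<in> \<S>\<^sub>0" for f using sum_S0[of X f] by (simp add: \<Phi>_def)
  have \<Phi>_lincomb: "\<Phi> (\<lambda>x. a * f x + b * g x) = (\<lambda>A. a * \<Phi> f A + b * \<Phi> g A)" for a b f g
    by (simp add: \<Phi>_def sum_distrib_left sum.distrib[symmetric] algebra_simps)
  have \<Phi>_diff: "\<Phi> (\<lambda>x. f x - g x) = \<Phi> f - \<Phi> g" for f g
    using \<Phi>_lincomb[of 1 f "-1" g] by (simp add: fun_diff_def)
  have singleton: "{x} \<in> sets \<M>" if "x \<in> X" for x
    using that by (auto simp: sets_restrict_space intro!: image_eqI[of _ _ "{x}"])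
  have \<Phi>_atoms: "\<Phi> (\<lambda>x. if x \<in> X then \<mu> {x} else 0) = \<mu>" if \<mu>: "\<mu> \<in> \<S>\<^sub>0" for \<mu>
  proof
    fix A
    have \<mu>': "\<mu> \<in> finite_signed_measures \<M>" "\<mu> X = 0"
      using \<mu> by (auto simp: signed_borel_measures_of_mass_def signed_borel_measures_def)
    have sum_atoms: "(\<Sum>x\<in>B. \<mu> {x}) = \<mu> B" if "B \<subseteq> X" for B
    proof -
      have "\<mu> (\<Union>x\<in>B. {x}) = (\<Sum>x\<in>B. \<mu> {x})"
        using finite_subset[OF that fin] that singleton
        by (intro fsm_UN[OF \<mu>'(1)]) (auto simp: disjoint_family_on_def)
      then show ?thesis by simp
    qed
    show "\<Phi> (\<lambda>x. if x \<in> X then \<mu> {x} else 0) A = \<mu> A"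
    proof (cases "A \<in> sets \<M>")
      case True
      then have "A \<subseteq> X" using sets.sets_into_space by fastforce
      \<comment> \<open>The base point collects the coefficient
        \<open>- (\<Sum>x\<in>X. \<mu> {x})\<close>, which is \<open>- \<mu> X = 0\<close>; what
        remains is the sum of the atoms in \<open>A\<close>.\<close>
      have "\<Phi> (\<lambda>x. if x \<in> X then \<mu> {x} else 0) A =
          (\<Sum>x\<in>X. \<mu> {x} * indicator A x) - (\<Sum>x\<in>X. \<mu> {x}) * indicator A y"
        using True unfolding \<Phi>_def dipole_def point_mass_def sum_distrib_right sum_subtractf[symmetric]
        by (intro sum.cong) (auto simp: algebra_simps)
      also have "(\<Sum>x\<in>X. \<mu> {x} * indicator A x) = (\<Sum>x\<in>A. \<mu> {x})"
        using fin \<open>A \<subseteq> X\<close> by (intro sum.mono_neutral_cong_right) (auto simp: indicator_def)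
      finally show ?thesis using sum_atoms \<open>A \<subseteq> X\<close> \<mu>'(2) by simp
    next
      case False
      then show ?thesis using fsm_notin[OF \<mu>'(1)] by (simp add: \<Phi>_def dipole_def point_mass_def)
    qed
  qed
  define F where "F n = (\<lambda>x. if x \<in> X then \<sigma> n {x} else 0)" for n
  have F: "\<Phi> (F n) = \<sigma> n" for n using \<Phi>_atoms \<sigma> by (auto simp: F_def)
  have "\<exists>g. (\<forall>x. x \<notin> X \<longrightarrow> g x = 0) \<and> (\<lambda>n. nrm (\<Phi> (\<lambda>x. F n x - g x))) \<longlonglongrightarrow> 0"
  proof (rule finite_support_seminorm_complete[where q = "\<lambda>f. nrm (\<Phi> f)"])
    show "nrm (\<Phi> (\<lambda>x. a * f x + b * g x)) \<le> \<bar>a\<bar> * nrm (\<Phi> f) + \<bar>b\<bar> * nrm (\<Phi> g)" for a b f g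
      unfolding \<Phi>_lincomb by (intro nrm_lincomb_le \<Phi>_S0)
    show "\<exists>N. \<forall>m\<ge>N. \<forall>n\<ge>N. nrm (\<Phi> (\<lambda>x. F m x - F n x)) < \<epsilon>" if "\<epsilon> > 0" for \<epsilon>
      using Cauchy that by (simp add: \<Phi>_diff F)
  qed (use fin in \<open>auto simp: F_def nrm_nonneg \<Phi>_S0\<close>)
  then obtain g where "(\<lambda>n. nrm (\<Phi> (\<lambda>x. F n x - g x))) \<longlonglongrightarrow> 0" by blast
  then show "\<exists>v\<in>\<S>\<^sub>0. (\<lambda>n. nrm (\<sigma> n - v)) \<longlonglongrightarrow> 0"
    using \<Phi>_S0 by (auto simp: \<Phi>_diff F)
qed

end

theorem theorem6p1:
  fixes X :: "'a::metric_space set"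
  assumes "compact X"
    and "quasihypermetric X"
    and "max_energy X < \<infinity>"
  shows "E0_complete X \<longleftrightarrow> finite X"
proof -
  interpret compact_quasihypermetric X
    by standard (rule assms)+
  show ?thesis
    using infinite_imp_not_complete finite_imp_complete by blast
qed

end
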